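(* Let $\mathcal{A}$ be a semi-abelian category satisfying the Smith is Huq condition (SH), and let $\xi^M_N\colon M\flat N\to N$ and $\xi^N_M\colon N\flat M\to M$ be compatible internal actions in $\mathcal{A}$, with Peiffer product $q\colon M+N\to M\bowtie N$; put $l_M=q\circ i_M$ and $l_N=q\circ i_N$. Among the pairs of internal crossed modules with common codomain inducing $\xi^M_N$ and $\xi^N_M$, the pair given by the Peiffer product (with structure morphisms $l_M$ and $l_N$) is initial in the following sense: for every pair of internal crossed modules $(\mu\colon M\to L,\ \xi^L_M)$ and $(\nu\colon N\to L,\ \xi^L_N)$ with $\xi^M_N=\xi^L_N\circ(\mu\flat 1_N)$ and $\xi^N_M=\xi^L_M\circ(\nu\flat 1_M)$, there exists a unique morphism $\phi\colon M\bowtie N\to L$ such that $\phi\circ l_M=\mu$ and $\phi\circ l_N=\nu$.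
   Context: A semi-abelian category is a pointed, Barr exact, Bourn protomodular category with binary coproducts. (SH): two internal equivalence relations on the same object centralise each other in the Smith–Pedicchio sense as soon as their normalisations (the corresponding normal subobjects) commute in the sense of Huq. Notation: $+$ is the coproduct (with $A+B$ and $B+A$ identified), $i_A\colon A\to A+B$ and $i_B\colon B\to A+B$ are the inclusions, $[f,g]\colon A+B\to C$ is the morphism induced by $f\colon A\to C$, $g\colon B\to C$. The functor $\flat$: $k_{A,B}\colon A\flat B\to A+B$ is the kernel of $[1_A,0]\colon A+B\to A$; for $f\colon A\to A'$, $g\colon B\to B'$, $f\flat g$ is the restriction of $f+g$ to kernels. For fixed $A$, $A\flat(-)$ is a monad with unit $\eta^A_B\colon B\to A\flat B$ determined by $k_{A,B}\circ\eta^A_B=i_B$ and multiplication $\mu^A_B\colon A\flat(A\flat B)\to A\flat B$ determined by $k_{A,B}\circ\mu^A_B=[i_A,k_{A,B}]\circ k_{A,A\flat B}$. An internal action of $A$ on $X$ is a morphism $\xi\colon A\flat X\to X$ making $X$ an algebra for this monad. The conjugation action is $\chi_A=[1_A,1_A]\circ k_{A,A}\colon A\flat A\to A$. Internal crossed module (under (SH)): a pair $(\partial\colon X\to A,\xi)$ with $\xi\colon A\flat X\to X$ an internal action such that $\xi\circ(\partial\flat 1_X)=\chi_X$ and $\partial\circ\xi=\chi_A\circ(1_A\flat\partial)$. Cosmash products: $h_{A,B}\colon A\diamond B\to A+B$ is the kernel of the canonical morphism $A+B\to A\times B$; it factors as $h_{A,B}=k_{A,B}\circ i_{A,B}$ with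 $i_{A,B}\colon A\diamond B\to A\flat B$. $h_{A,B,C}\colon A\diamond B\diamond C\to A+B+C$ is the kernel of the morphism $A+B+C\to(A+B)\times(A+C)\times(B+C)$ with components $[i_A,i_B,0]$, $[i_A,0,i_C]$, $[0,i_B,i_C]$. The morphism $j_{A,B,C}\colon A\diamond B\diamond C\to(A+B)\flat C$ is the unique one with $k_{A+B,C}\circ j_{A,B,C}=h_{A,B,C}$. The folding morphism $S^{N,M}_{1,2}\colon M\diamond N\diamond M\to N\diamond M$ is the unique one such that $h_{N,M}\circ S^{N,M}_{1,2}$ equals $h_{M,N,M}$ followed by the morphism $M+N+M\to M+N$ which folds the two copies of $M$ by the codiagonal and is the identity on $N$. Similarly $S^{M,N}_{1,2}\colon M\diamond N\diamond N\to M\diamond N$ is induced by folding the two copies of $N$. Compatibility: internal actions $\xi^M_N\colon M\flat N\to N$ and $\xi^N_M\colon N\flat M\to M$ are compatible if there exist internal actions $\xi^{M+N}_M\colon(M+N)\flat M\to M$ and $\xi^{M+N}_N\colon(M+N)\flat N\to N$ (these are then uniquely determined) such that: (CA.0) $\xi^{M+N}_M\circ(i_N\flat 1_M)=\xi^N_M$, $\ \xi^{M+N}_M\circ(i_M\flat 1_M)=\chi_M$, $\ \xi^{M+N}_M\circ j_{M,N,M}=\xi^N_M\circ i_{N,M}\circ S^{N,M}_{1,2}$, and $\xi^{M+N}_N\circ(i_M\flat 1_N)=\xi^M_N$, $\ \xi^{M+N}_N\circ(i_N\flat 1_N)=\chi_N$, $\ \xi^{M+N}_N\circ j_{M,N,N}=\xi^M_N\circ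 i_{M,N}\circ S^{M,N}_{1,2}$; (CA.M) $\xi^{M+N}_M\circ\big((\xi^N_M+\xi^M_N)\flat 1_M\big)=\xi^{M+N}_M\circ\big([k_{N,M},k_{M,N}]\flat 1_M\big)$ as morphisms $((N\flat M)+(M\flat N))\flat M\to M$; (CA.N) $\xi^{M+N}_N\circ\big((\xi^N_M+\xi^M_N)\flat 1_N\big)=\xi^{M+N}_N\circ\big([k_{N,M},k_{M,N}]\flat 1_N\big)$ as morphisms $((N\flat M)+(M\flat N))\flat N\to N$. Peiffer product: $q\colon M+N\to M\bowtie N$ is the coequaliser of the two morphisms $[k_{N,M},k_{M,N}]$ and $\xi^N_M+\xi^M_N$ from $(N\flat M)+(M\flat N)$ to $M+N$. For compatible actions, $l_M$ and $l_N$ carry internal crossed module structures inducing $\xi^M_N$ and $\xi^N_M$, with actions $\xi^{M\bowtie N}_M$, $\xi^{M\bowtie N}_N$ determined by $\xi^{M\bowtie N}_M\circ(q\flat 1_M)=\xi^{M+N}_M$ and $\xi^{M\bowtie N}_N\circ(q\flat 1_N)=\xi^{M+N}_N$. *)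

theory Defs
  imports Main
begin

section \<open>Categories and universal properties\<close>

record ('o, 'm) cat =
  Obj :: "'o set"
  Arr :: "'m set"
  Dom :: "'m \<Rightarrow> 'o"
  Cod :: "'m \<Rightarrow> 'o"
  Id :: "'o \<Rightarrow> 'm"
  Comp :: "'m \<Rightarrow> 'm \<Rightarrow> 'm" (infixl "\<cdot>\<index>" 70)

definition hom :: "('o, 'm, 'z) cat_scheme \<Rightarrow> 'o \<Rightarrow> 'o \<Rightarrow> 'm set" where
  "hom C A B = {f \<in> Arr C. Dom C f = A \<and> Cod C f = B}"

locale category =
  fixes C :: "('o, 'm, 'z) cat_scheme" (structure)
  assumes Dom_obj: "f \<in> Arr C \<Longrightarrow> Dom C f \<in> Obj C"
    and Cod_obj: "f \<in> Arr C \<Longrightarrow> Cod C f \<in> Obj C"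
    and Id_hom: "A \<in> Obj C \<Longrightarrow> Id C A \<in> hom C A A"
    and Comp_hom: "f \<in> hom C A B \<Longrightarrow> g \<in> hom C B D \<Longrightarrow> g \<cdot> f \<in> hom C A D"
    and Comp_Id: "f \<in> hom C A B \<Longrightarrow> f \<cdot> Id C A = f"
    and Id_Comp: "f \<in> hom C A B \<Longrightarrow> Id C B \<cdot> f = f"
    and Comp_assoc: "f \<in> hom C A B \<Longrightarrow> g \<in> hom C B D \<Longrightarrow> h \<in> hom C D E
          \<Longrightarrow> (h \<cdot> g) \<cdot> f = h \<cdot> (g \<cdot> f)"

definition is_iso :: "('o, 'm, 'z) cat_scheme \<Rightarrow> 'm \<Rightarrow> bool" where
  "is_iso C f \<longleftrightarrow> f \<in> Arr C \<and>
     (\<exists>g \<in> hom C (Cod C f) (Dom C f).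
        g \<cdot>\<^bsub>C\<^esub> f = Id C (Dom C f) \<and> f \<cdot>\<^bsub>C\<^esub> g = Id C (Cod C f))"

definition is_zero_object :: "('o, 'm, 'z) cat_scheme \<Rightarrow> 'o \<Rightarrow> bool" where
  "is_zero_object C Z \<longleftrightarrow> Z \<in> Obj C \<and>
     (\<forall>A \<in> Obj C. (\<exists>!f. f \<in> hom C A Z) \<and> (\<exists>!f. f \<in> hom C Z A))"

definition zero_arr :: "('o, 'm, 'z) cat_scheme \<Rightarrow> 'o \<Rightarrow> 'o \<Rightarrow> 'm" where
  "zero_arr C A B = (THE f. \<exists>Z g h. is_zero_object C Z \<and> g \<in> hom C A Z \<and> h \<in> hom C Z B
     \<and> f = h \<cdot>\<^bsub>C\<^esub> g)"

definition is_product ::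
  "('o, 'm, 'z) cat_scheme \<Rightarrow> 'o \<Rightarrow> 'o \<Rightarrow> 'o \<Rightarrow> 'm \<Rightarrow> 'm \<Rightarrow> bool" where
  "is_product C A B P p q \<longleftrightarrow> p \<in> hom C P A \<and> q \<in> hom C P B \<and>
     (\<forall>X. \<forall>f \<in> hom C X A. \<forall>g \<in> hom C X B.
        \<exists>!u. u \<in> hom C X P \<and> p \<cdot>\<^bsub>C\<^esub> u = f \<and> q \<cdot>\<^bsub>C\<^esub> u = g)"

definition is_coproduct ::
  "('o, 'm, 'z) cat_scheme \<Rightarrow> 'o \<Rightarrow> 'o \<Rightarrow> 'o \<Rightarrow> 'm \<Rightarrow> 'm \<Rightarrow> bool" where
  "is_coproduct C A B S i j \<longleftrightarrow> i \<in> hom C A S \<and> j \<in> hom C B S \<and>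
     (\<forall>X. \<forall>f \<in> hom C A X. \<forall>g \<in> hom C B X.
        \<exists>!u. u \<in> hom C S X \<and> u \<cdot>\<^bsub>C\<^esub> i = f \<and> u \<cdot>\<^bsub>C\<^esub> j = g)"

definition is_pullback :: "('o, 'm, 'z) cat_scheme \<Rightarrow> 'm \<Rightarrow> 'm \<Rightarrow> 'm \<Rightarrow> 'm \<Rightarrow> bool" where
  "is_pullback C f g p q \<longleftrightarrow>
     f \<in> Arr C \<and> g \<in> Arr C \<and> p \<in> Arr C \<and> q \<in> Arr C \<and>
     Cod C f = Cod C g \<and> Dom C p = Dom C q \<and> Cod C p = Dom C f \<and> Cod C q = Dom C g \<and>
     f \<cdot>\<^bsub>C\<^esub> p = g \<cdot>\<^bsub>C\<^esub> q \<and>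
     (\<forall>X. \<forall>x \<in> hom C X (Dom C f). \<forall>y \<in> hom C X (Dom C g). f \<cdot>\<^bsub>C\<^esub> x = g \<cdot>\<^bsub>C\<^esub> y \<longrightarrow>
        (\<exists>!u. u \<in> hom C X (Dom C p) \<and> p \<cdot>\<^bsub>C\<^esub> u = x \<and> q \<cdot>\<^bsub>C\<^esub> u = y))"

definition is_coequaliser :: "('o, 'm, 'z) cat_scheme \<Rightarrow> 'm \<Rightarrow> 'm \<Rightarrow> 'm \<Rightarrow> bool" where
  "is_coequaliser C f g e \<longleftrightarrow>
     f \<in> Arr C \<and> g \<in> Arr C \<and> e \<in> Arr C \<and>
     Dom C f = Dom C g \<and> Cod C f = Cod C g \<and> Dom C e = Cod C f \<and>
     e \<cdot>\<^bsub>C\<^esub> f = e \<cdot>\<^bsub>C\<^esub> g \<and>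
     (\<forall>X. \<forall>h \<in> hom C (Cod C f) X. h \<cdot>\<^bsub>C\<^esub> f = h \<cdot>\<^bsub>C\<^esub> g \<longrightarrow>
        (\<exists>!u. u \<in> hom C (Cod C e) X \<and> u \<cdot>\<^bsub>C\<^esub> e = h))"

definition is_kernel :: "('o, 'm, 'z) cat_scheme \<Rightarrow> 'm \<Rightarrow> 'm \<Rightarrow> bool" where
  "is_kernel C f k \<longleftrightarrow>
     f \<in> Arr C \<and> k \<in> Arr C \<and> Cod C k = Dom C f \<and>
     f \<cdot>\<^bsub>C\<^esub> k = zero_arr C (Dom C k) (Cod C f) \<and>
     (\<forall>X. \<forall>h \<in> hom C X (Dom C f). f \<cdot>\<^bsub>C\<^esub> h = zero_arr C X (Cod C f) \<longrightarrow>
        (\<exists>!u. u \<in> hom C X (Dom C k) \<and> k \<cdot>\<^bsub>C\<^esub> u = h))"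

definition is_regular_epi :: "('o, 'm, 'z) cat_scheme \<Rightarrow> 'm \<Rightarrow> bool" where
  "is_regular_epi C e \<longleftrightarrow> (\<exists>f g. is_coequaliser C f g e)"


section \<open>Semi-abelian categories\<close>

definition equivalence_relation ::
  "('o, 'm, 'z) cat_scheme \<Rightarrow> 'o \<Rightarrow> 'm \<Rightarrow> 'm \<Rightarrow> bool" where
  "equivalence_relation C X r\<^sub>1 r\<^sub>2 \<longleftrightarrow>
     r\<^sub>1 \<in> hom C (Dom C r\<^sub>1) X \<and> r\<^sub>2 \<in> hom C (Dom C r\<^sub>1) X \<and>
     (\<forall>T. \<forall>u \<in> hom C T (Dom C r\<^sub>1). \<forall>v \<in> hom C T (Dom C r\<^sub>1).
        r\<^sub>1 \<cdot>\<^bsub>C\<^esub> u = r\<^sub>1 \<cdot>\<^bsub>C\<^esub> v \<and> r\<^sub>2 \<cdot>\<^bsub>C\<^esub> u = r\<^sub>2 \<cdot>\<^bsub>C\<^esub> v \<longrightarrow> u = v) \<and>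
     (\<exists>d \<in> hom C X (Dom C r\<^sub>1). r\<^sub>1 \<cdot>\<^bsub>C\<^esub> d = Id C X \<and> r\<^sub>2 \<cdot>\<^bsub>C\<^esub> d = Id C X) \<and>
     (\<exists>s \<in> hom C (Dom C r\<^sub>1) (Dom C r\<^sub>1). r\<^sub>1 \<cdot>\<^bsub>C\<^esub> s = r\<^sub>2 \<and> r\<^sub>2 \<cdot>\<^bsub>C\<^esub> s = r\<^sub>1) \<and>
     (\<forall>p q. is_pullback C r\<^sub>2 r\<^sub>1 p q \<longrightarrow>
        (\<exists>t \<in> hom C (Dom C p) (Dom C r\<^sub>1).
           r\<^sub>1 \<cdot>\<^bsub>C\<^esub> t = r\<^sub>1 \<cdot>\<^bsub>C\<^esub> p \<and> r\<^sub>2 \<cdot>\<^bsub>C\<^esub> t = r\<^sub>2 \<cdot>\<^bsub>C\<^esub> q))"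

definition is_point :: "('o, 'm, 'z) cat_scheme \<Rightarrow> 'o \<Rightarrow> 'm \<Rightarrow> 'm \<Rightarrow> bool" where
  "is_point C B p s \<longleftrightarrow>
     p \<in> hom C (Dom C p) B \<and> s \<in> hom C B (Dom C p) \<and> p \<cdot>\<^bsub>C\<^esub> s = Id C B"

text \<open>Bourn protomodularity: pulling back points along any \<open>f\<close> reflects isomorphisms.
  Here \<open>u\<close> is the image of \<open>h\<close> under the change-of-base functor along \<open>f\<close>; being compatible
  with the projections, it is compatible with the induced sections as well.\<close>

definition protomodular :: "('o, 'm, 'z) cat_scheme \<Rightarrow> bool" where
  "protomodular C \<longleftrightarrow>
     (\<forall>f p s p' s' h a b a' b' u.
        is_point C (Cod C f) p s \<and> is_point C (Cod C f) p' s' \<and>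
        h \<in> hom C (Dom C p) (Dom C p') \<and> p' \<cdot>\<^bsub>C\<^esub> h = p \<and> h \<cdot>\<^bsub>C\<^esub> s = s' \<and>
        is_pullback C f p a b \<and> is_pullback C f p' a' b' \<and>
        u \<in> hom C (Dom C a) (Dom C a') \<and> a' \<cdot>\<^bsub>C\<^esub> u = a \<and> b' \<cdot>\<^bsub>C\<^esub> u = h \<cdot>\<^bsub>C\<^esub> b \<and>
        is_iso C u \<longrightarrow> is_iso C h)"

text \<open>Finite limits are given by pullbacks together with the terminal (here: zero) object.\<close>

locale semi_abelian = category C
  for C :: "('o, 'm, 'z) cat_scheme" (structure) +
  assumes pointed: "\<exists>Z. is_zero_object C Z"
    and pullbacks: "\<lbrakk>f \<in> Arr C; g \<in> Arr C; Cod C f = Cod C g\<rbrakk> \<Longrightarrow> \<exists>p q. is_pullback C f g p q"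
    and kernel_pair_coequalisers: "is_pullback C f f p q \<Longrightarrow> \<exists>e. is_coequaliser C p q e"
    and regular_epis_stable:
      "\<lbrakk>is_regular_epi C e; is_pullback C f e p q\<rbrakk> \<Longrightarrow> is_regular_epi C p"
    and equivalence_relations_effective:
      "equivalence_relation C X r\<^sub>1 r\<^sub>2 \<Longrightarrow> \<exists>f. is_pullback C f f r\<^sub>1 r\<^sub>2"
    and protomodular: "protomodular C"
    and coproducts: "\<lbrakk>A \<in> Obj C; B \<in> Obj C\<rbrakk> \<Longrightarrow> \<exists>S i j. is_coproduct C A B S i j"


section \<open>The Smith is Huq condition\<close>

definition huq_commute :: "('o, 'm, 'z) cat_scheme \<Rightarrow> 'm \<Rightarrow> 'm \<Rightarrow> bool" where
  "huq_commute C k l \<longleftrightarrow>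
     (\<exists>P p q e\<^sub>1 e\<^sub>2 \<phi>.
        is_product C (Dom C k) (Dom C l) P p q \<and>
        e\<^sub>1 \<in> hom C (Dom C k) P \<and> p \<cdot>\<^bsub>C\<^esub> e\<^sub>1 = Id C (Dom C k) \<and>
        q \<cdot>\<^bsub>C\<^esub> e\<^sub>1 = zero_arr C (Dom C k) (Dom C l) \<and>
        e\<^sub>2 \<in> hom C (Dom C l) P \<and> p \<cdot>\<^bsub>C\<^esub> e\<^sub>2 = zero_arr C (Dom C l) (Dom C k) \<and>
        q \<cdot>\<^bsub>C\<^esub> e\<^sub>2 = Id C (Dom C l) \<and>
        \<phi> \<in> hom C P (Cod C k) \<and> \<phi> \<cdot>\<^bsub>C\<^esub> e\<^sub>1 = k \<and> \<phi> \<cdot>\<^bsub>C\<^esub> e\<^sub>2 = l)"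

text \<open>Existence of a connector \<open>\<theta>\<close> on the pullback of \<open>r\<^sub>2\<close> and \<open>s\<^sub>1\<close>, that is
  \<open>\<theta>(x,y,y) = x\<close> and \<open>\<theta>(y,y,z) = z\<close>. Semi-abelian categories are Mal'tsev, so the remaining
  connector axioms are automatic. The arrows \<open>d\<^sub>R\<close>, \<open>d\<^sub>S\<close> are the reflexivities, and \<open>e\<^sub>R\<close>, \<open>e\<^sub>S\<close> are
  \<open>(x,y) \<mapsto> (x,y,y)\<close> and \<open>(y,z) \<mapsto> (y,y,z)\<close>.\<close>

definition smith_commute ::
  "('o, 'm, 'z) cat_scheme \<Rightarrow> 'o \<Rightarrow> 'm \<Rightarrow> 'm \<Rightarrow> 'm \<Rightarrow> 'm \<Rightarrow> bool" where
  "smith_commute C X r\<^sub>1 r\<^sub>2 s\<^sub>1 s\<^sub>2 \<longleftrightarrow>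
     (\<exists>p q d\<^sub>R d\<^sub>S e\<^sub>R e\<^sub>S \<theta>.
        is_pullback C r\<^sub>2 s\<^sub>1 p q \<and>
        d\<^sub>R \<in> hom C X (Dom C r\<^sub>1) \<and> r\<^sub>1 \<cdot>\<^bsub>C\<^esub> d\<^sub>R = Id C X \<and> r\<^sub>2 \<cdot>\<^bsub>C\<^esub> d\<^sub>R = Id C X \<and>
        d\<^sub>S \<in> hom C X (Dom C s\<^sub>1) \<and> s\<^sub>1 \<cdot>\<^bsub>C\<^esub> d\<^sub>S = Id C X \<and> s\<^sub>2 \<cdot>\<^bsub>C\<^esub> d\<^sub>S = Id C X \<and>
        e\<^sub>R \<in> hom C (Dom C r\<^sub>1) (Dom C p) \<and>
        p \<cdot>\<^bsub>C\<^esub> e\<^sub>R = Id C (Dom C r\<^sub>1) \<and> q \<cdot>\<^bsub>C\<^esub> e\<^sub>R = d\<^sub>S \<cdot>\<^bsub>C\<^esub> r\<^sub>2 \<and>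
        e\<^sub>S \<in> hom C (Dom C s\<^sub>1) (Dom C p) \<and>
        p \<cdot>\<^bsub>C\<^esub> e\<^sub>S = d\<^sub>R \<cdot>\<^bsub>C\<^esub> s\<^sub>1 \<and> q \<cdot>\<^bsub>C\<^esub> e\<^sub>S = Id C (Dom C s\<^sub>1) \<and>
        \<theta> \<in> hom C (Dom C p) X \<and> \<theta> \<cdot>\<^bsub>C\<^esub> e\<^sub>R = r\<^sub>1 \<and> \<theta> \<cdot>\<^bsub>C\<^esub> e\<^sub>S = s\<^sub>2)"

text \<open>The normalisation of \<open>(r\<^sub>1, r\<^sub>2)\<close> is \<open>r\<^sub>2\<close> restricted to the kernel of \<open>r\<^sub>1\<close>.\<close>

definition smith_is_huq :: "('o, 'm, 'z) cat_scheme \<Rightarrow> bool" where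
  "smith_is_huq C \<longleftrightarrow>
     (\<forall>X r\<^sub>1 r\<^sub>2 s\<^sub>1 s\<^sub>2 m n.
        equivalence_relation C X r\<^sub>1 r\<^sub>2 \<and> equivalence_relation C X s\<^sub>1 s\<^sub>2 \<and>
        is_kernel C r\<^sub>1 m \<and> is_kernel C s\<^sub>1 n \<and>
        huq_commute C (r\<^sub>2 \<cdot>\<^bsub>C\<^esub> m) (s\<^sub>2 \<cdot>\<^bsub>C\<^esub> n)
        \<longrightarrow> smith_commute C X r\<^sub>1 r\<^sub>2 s\<^sub>1 s\<^sub>2)"


section \<open>Chosen coproducts, products and kernels\<close>

record ('o, 'm) chosen_cat = "('o, 'm) cat" +
  Sum :: "'o \<Rightarrow> 'o \<Rightarrow> 'o"
  Inl :: "'o \<Rightarrow> 'o \<Rightarrow> 'm"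
  Inr :: "'o \<Rightarrow> 'o \<Rightarrow> 'm"
  Prd :: "'o \<Rightarrow> 'o \<Rightarrow> 'o"
  Prl :: "'o \<Rightarrow> 'o \<Rightarrow> 'm"
  Prr :: "'o \<Rightarrow> 'o \<Rightarrow> 'm"
  Ker :: "'m \<Rightarrow> 'm"

text \<open>An arbitrary choice of universal objects, not a property of the category.\<close>

locale chosen_limits =
  fixes C :: "('o, 'm, 'z) chosen_cat_scheme" (structure)
  assumes Sum: "\<lbrakk>A \<in> Obj C; B \<in> Obj C\<rbrakk> \<Longrightarrow> is_coproduct C A B (Sum C A B) (Inl C A B) (Inr C A B)"
    and Prd: "\<lbrakk>A \<in> Obj C; B \<in> Obj C\<rbrakk> \<Longrightarrow> is_product C A B (Prd C A B) (Prl C A B) (Prr C A B)"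
    and Ker: "f \<in> Arr C \<Longrightarrow> is_kernel C f (Ker C f)"

definition copair :: "('o, 'm, 'z) chosen_cat_scheme \<Rightarrow> 'm \<Rightarrow> 'm \<Rightarrow> 'm" where
  "copair C f g = (THE u. u \<in> hom C (Sum C (Dom C f) (Dom C g)) (Cod C f) \<and>
     u \<cdot>\<^bsub>C\<^esub> Inl C (Dom C f) (Dom C g) = f \<and> u \<cdot>\<^bsub>C\<^esub> Inr C (Dom C f) (Dom C g) = g)"

definition pair :: "('o, 'm, 'z) chosen_cat_scheme \<Rightarrow> 'm \<Rightarrow> 'm \<Rightarrow> 'm" where
  "pair C f g = (THE u. u \<in> hom C (Dom C f) (Prd C (Cod C f) (Cod C g)) \<and>
     Prl C (Cod C f) (Cod C g) \<cdot>\<^bsub>C\<^esub> u = f \<and> Prr C (Cod C f) (Cod C g) \<cdot>\<^bsub>C\<^esub> u = g)"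

definition sum_map :: "('o, 'm, 'z) chosen_cat_scheme \<Rightarrow> 'm \<Rightarrow> 'm \<Rightarrow> 'm" where
  "sum_map C f g = copair C (Inl C (Cod C f) (Cod C g) \<cdot>\<^bsub>C\<^esub> f) (Inr C (Cod C f) (Cod C g) \<cdot>\<^bsub>C\<^esub> g)"

text \<open>The canonical isomorphism \<open>A + B \<rightarrow> B + A\<close>, used wherever the two coproducts are identified.\<close>

definition sum_swap :: "('o, 'm, 'z) chosen_cat_scheme \<Rightarrow> 'o \<Rightarrow> 'o \<Rightarrow> 'm" where
  "sum_swap C A B = copair C (Inr C B A) (Inl C B A)"


section \<open>Internal actions and internal crossed modules\<close>

definition flat_ker :: "('o, 'm, 'z) chosen_cat_scheme \<Rightarrow> 'o \<Rightarrow> 'o \<Rightarrow> 'm" where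
  "flat_ker C A B = Ker C (copair C (Id C A) (zero_arr C B A))"

definition flat :: "('o, 'm, 'z) chosen_cat_scheme \<Rightarrow> 'o \<Rightarrow> 'o \<Rightarrow> 'o" where
  "flat C A B = Dom C (flat_ker C A B)"

definition flat_map :: "('o, 'm, 'z) chosen_cat_scheme \<Rightarrow> 'm \<Rightarrow> 'm \<Rightarrow> 'm" where
  "flat_map C f g = (THE u. u \<in> hom C (flat C (Dom C f) (Dom C g)) (flat C (Cod C f) (Cod C g)) \<and>
     flat_ker C (Cod C f) (Cod C g) \<cdot>\<^bsub>C\<^esub> u
       = sum_map C f g \<cdot>\<^bsub>C\<^esub> flat_ker C (Dom C f) (Dom C g))"

definition flat_unit :: "('o, 'm, 'z) chosen_cat_scheme \<Rightarrow> 'o \<Rightarrow> 'o \<Rightarrow> 'm" where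
  "flat_unit C A B = (THE u. u \<in> hom C B (flat C A B) \<and> flat_ker C A B \<cdot>\<^bsub>C\<^esub> u = Inr C A B)"

definition flat_mult :: "('o, 'm, 'z) chosen_cat_scheme \<Rightarrow> 'o \<Rightarrow> 'o \<Rightarrow> 'm" where
  "flat_mult C A B = (THE u. u \<in> hom C (flat C A (flat C A B)) (flat C A B) \<and>
     flat_ker C A B \<cdot>\<^bsub>C\<^esub> u
       = copair C (Inl C A B) (flat_ker C A B) \<cdot>\<^bsub>C\<^esub> flat_ker C A (flat C A B))"

definition internal_action :: "('o, 'm, 'z) chosen_cat_scheme \<Rightarrow> 'o \<Rightarrow> 'o \<Rightarrow> 'm \<Rightarrow> bool" where
  "internal_action C A X \<xi> \<longleftrightarrow>
     A \<in> Obj C \<and> X \<in> Obj C \<and> \<xi> \<in> hom C (flat C A X) X \<and>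
     \<xi> \<cdot>\<^bsub>C\<^esub> flat_unit C A X = Id C X \<and>
     \<xi> \<cdot>\<^bsub>C\<^esub> flat_mult C A X = \<xi> \<cdot>\<^bsub>C\<^esub> flat_map C (Id C A) \<xi>"

definition conj_action :: "('o, 'm, 'z) chosen_cat_scheme \<Rightarrow> 'o \<Rightarrow> 'm" where
  "conj_action C A = copair C (Id C A) (Id C A) \<cdot>\<^bsub>C\<^esub> flat_ker C A A"

definition internal_crossed_module ::
  "('o, 'm, 'z) chosen_cat_scheme \<Rightarrow> 'o \<Rightarrow> 'o \<Rightarrow> 'm \<Rightarrow> 'm \<Rightarrow> bool" where
  "internal_crossed_module C X A d \<xi> \<longleftrightarrow>
     d \<in> hom C X A \<and> internal_action C A X \<xi> \<and>
     \<xi> \<cdot>\<^bsub>C\<^esub> flat_map C d (Id C X) = conj_action C X \<and>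
     d \<cdot>\<^bsub>C\<^esub> \<xi> = conj_action C A \<cdot>\<^bsub>C\<^esub> flat_map C (Id C A) d"


section \<open>Cosmash products\<close>

definition cosmash_ker :: "('o, 'm, 'z) chosen_cat_scheme \<Rightarrow> 'o \<Rightarrow> 'o \<Rightarrow> 'm" where
  "cosmash_ker C A B = Ker C (pair C (copair C (Id C A) (zero_arr C B A))
                                     (copair C (zero_arr C A B) (Id C B)))"

definition cosmash :: "('o, 'm, 'z) chosen_cat_scheme \<Rightarrow> 'o \<Rightarrow> 'o \<Rightarrow> 'o" where
  "cosmash C A B = Dom C (cosmash_ker C A B)"

definition cosmash_flat :: "('o, 'm, 'z) chosen_cat_scheme \<Rightarrow> 'o \<Rightarrow> 'o \<Rightarrow> 'm" where
  "cosmash_flat C A B = (THE u. u \<in> hom C (cosmash C A B) (flat C A B) \<and>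
     flat_ker C A B \<cdot>\<^bsub>C\<^esub> u = cosmash_ker C A B)"

text \<open>Ternary coproducts are bracketed as \<open>(A + B) + D\<close>.\<close>

definition cosmash3_ker :: "('o, 'm, 'z) chosen_cat_scheme \<Rightarrow> 'o \<Rightarrow> 'o \<Rightarrow> 'o \<Rightarrow> 'm" where
  "cosmash3_ker C A B D =
     Ker C (pair C
       (pair C
         (copair C (copair C (Inl C A B) (Inr C A B)) (zero_arr C D (Sum C A B)))
         (copair C (copair C (Inl C A D) (zero_arr C B (Sum C A D))) (Inr C A D)))
       (copair C (copair C (zero_arr C A (Sum C B D)) (Inl C B D)) (Inr C B D)))"

definition cosmash3 :: "('o, 'm, 'z) chosen_cat_scheme \<Rightarrow> 'o \<Rightarrow> 'o \<Rightarrow> 'o \<Rightarrow> 'o" where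
  "cosmash3 C A B D = Dom C (cosmash3_ker C A B D)"

definition cosmash3_flat :: "('o, 'm, 'z) chosen_cat_scheme \<Rightarrow> 'o \<Rightarrow> 'o \<Rightarrow> 'o \<Rightarrow> 'm" where
  "cosmash3_flat C A B D = (THE u. u \<in> hom C (cosmash3 C A B D) (flat C (Sum C A B) D) \<and>
     flat_ker C (Sum C A B) D \<cdot>\<^bsub>C\<^esub> u = cosmash3_ker C A B D)"

text \<open>The folding morphisms \<open>S\<^sub>1\<^sub>,\<^sub>2\<close>: \<open>fold_outer C N M\<close> goes from \<open>M \<diamond> N \<diamond> M\<close> to \<open>N \<diamond> M\<close>, and
  \<open>fold_last C M N\<close> goes from \<open>M \<diamond> N \<diamond> N\<close> to \<open>M \<diamond> N\<close>. In the former, the fold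
  \<open>M + N + M \<rightarrow> M + N\<close> is written with values in \<open>N + M\<close>.\<close>

definition fold_outer :: "('o, 'm, 'z) chosen_cat_scheme \<Rightarrow> 'o \<Rightarrow> 'o \<Rightarrow> 'm" where
  "fold_outer C N M = (THE u. u \<in> hom C (cosmash3 C M N M) (cosmash C N M) \<and>
     cosmash_ker C N M \<cdot>\<^bsub>C\<^esub> u
       = copair C (copair C (Inr C N M) (Inl C N M)) (Inr C N M) \<cdot>\<^bsub>C\<^esub> cosmash3_ker C M N M)"

definition fold_last :: "('o, 'm, 'z) chosen_cat_scheme \<Rightarrow> 'o \<Rightarrow> 'o \<Rightarrow> 'm" where
  "fold_last C M N = (THE u. u \<in> hom C (cosmash3 C M N N) (cosmash C M N) \<and>
     cosmash_ker C M N \<cdot>\<^bsub>C\<^esub> u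
       = copair C (copair C (Inl C M N) (Inr C M N)) (Inr C M N) \<cdot>\<^bsub>C\<^esub> cosmash3_ker C M N N)"


section \<open>Compatible actions and the Peiffer product\<close>

text \<open>The morphism \<open>[k\<^sub>N\<^sub>,\<^sub>M, k\<^sub>M\<^sub>,\<^sub>N] : (N \<flat> M) + (M \<flat> N) \<rightarrow> M + N\<close>.\<close>

definition flat_kers :: "('o, 'm, 'z) chosen_cat_scheme \<Rightarrow> 'o \<Rightarrow> 'o \<Rightarrow> 'm" where
  "flat_kers C M N = copair C (sum_swap C N M \<cdot>\<^bsub>C\<^esub> flat_ker C N M) (flat_ker C M N)"

text \<open>In the next two definitions \<open>\<xi>\<^sub>N\<close> is the action of \<open>M\<close> on \<open>N\<close>, and \<open>\<xi>\<^sub>M\<close> that of \<open>N\<close> on \<open>M\<close>;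
  \<open>\<zeta>\<^sub>M\<close> and \<open>\<zeta>\<^sub>N\<close> are the actions of \<open>M + N\<close>.\<close>

definition compatible_actions ::
  "('o, 'm, 'z) chosen_cat_scheme \<Rightarrow> 'o \<Rightarrow> 'o \<Rightarrow> 'm \<Rightarrow> 'm \<Rightarrow> bool" where
  "compatible_actions C M N \<xi>\<^sub>N \<xi>\<^sub>M \<longleftrightarrow>
     internal_action C M N \<xi>\<^sub>N \<and> internal_action C N M \<xi>\<^sub>M \<and>
     (\<exists>\<zeta>\<^sub>M \<zeta>\<^sub>N.
        internal_action C (Sum C M N) M \<zeta>\<^sub>M \<and>
        internal_action C (Sum C M N) N \<zeta>\<^sub>N \<and>
        \<zeta>\<^sub>M \<cdot>\<^bsub>C\<^esub> flat_map C (Inr C M N) (Id C M) = \<xi>\<^sub>M \<and>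
        \<zeta>\<^sub>M \<cdot>\<^bsub>C\<^esub> flat_map C (Inl C M N) (Id C M) = conj_action C M \<and>
        \<zeta>\<^sub>M \<cdot>\<^bsub>C\<^esub> cosmash3_flat C M N M = \<xi>\<^sub>M \<cdot>\<^bsub>C\<^esub> cosmash_flat C N M \<cdot>\<^bsub>C\<^esub> fold_outer C N M \<and>
        \<zeta>\<^sub>N \<cdot>\<^bsub>C\<^esub> flat_map C (Inl C M N) (Id C N) = \<xi>\<^sub>N \<and>
        \<zeta>\<^sub>N \<cdot>\<^bsub>C\<^esub> flat_map C (Inr C M N) (Id C N) = conj_action C N \<and>
        \<zeta>\<^sub>N \<cdot>\<^bsub>C\<^esub> cosmash3_flat C M N N = \<xi>\<^sub>N \<cdot>\<^bsub>C\<^esub> cosmash_flat C M N \<cdot>\<^bsub>C\<^esub> fold_last C M N \<and>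
        \<zeta>\<^sub>M \<cdot>\<^bsub>C\<^esub> flat_map C (sum_map C \<xi>\<^sub>M \<xi>\<^sub>N) (Id C M)
          = \<zeta>\<^sub>M \<cdot>\<^bsub>C\<^esub> flat_map C (flat_kers C M N) (Id C M) \<and>
        \<zeta>\<^sub>N \<cdot>\<^bsub>C\<^esub> flat_map C (sum_map C \<xi>\<^sub>M \<xi>\<^sub>N) (Id C N)
          = \<zeta>\<^sub>N \<cdot>\<^bsub>C\<^esub> flat_map C (flat_kers C M N) (Id C N))"

definition is_peiffer_product ::
  "('o, 'm, 'z) chosen_cat_scheme \<Rightarrow> 'o \<Rightarrow> 'o \<Rightarrow> 'm \<Rightarrow> 'm \<Rightarrow> 'm \<Rightarrow> bool" where
  "is_peiffer_product C M N \<xi>\<^sub>N \<xi>\<^sub>M q \<longleftrightarrow>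
     is_coequaliser C (flat_kers C M N) (sum_map C \<xi>\<^sub>M \<xi>\<^sub>N) q"

end

theory Submission
  imports Defs
begin

text \<open>
  The morphism \<open>[\<mu>, \<nu>] : M + N \<rightarrow> L\<close> coequalises the two morphisms defining the Peiffer product. On the
  summand \<open>N \<flat> M\<close> this reads \<open>[\<nu>, \<mu>] \<circ> k = \<mu> \<circ> \<xi>\<close>; since \<open>[\<nu>, \<mu>] = [1, 1] \<circ> (\<nu> + \<mu>)\<close>, the left-hand side is
  \<open>\<chi> \<circ> (1 \<flat> \<mu>) \<circ> (\<nu> \<flat> 1)\<close>, and equivariance of the crossed module \<open>\<mu>\<close> turns it into
  \<open>\<mu> \<circ> \<xi>\<close>, because the action of \<open>N\<close> on \<open>M\<close> is induced along \<open>\<nu>\<close>. The summand \<open>M \<flat> N\<close> is symmetric.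
\<close>

section \<open>Zero morphisms in a pointed category\<close>

locale pointed_chosen_limits = category C + chosen_limits C
  for C :: "('o, 'm, 'z) chosen_cat_scheme" (structure) +
  assumes zero_object: "\<exists>Z. is_zero_object C Z"
begin

lemma homD: "f \<in> hom C A B \<Longrightarrow> f \<in> Arr C \<and> Dom C f = A \<and> Cod C f = B \<and> A \<in> Obj C \<and> B \<in> Obj C"
  using Dom_obj Cod_obj by (auto simp: hom_def)

lemma homI: "f \<in> Arr C \<Longrightarrow> f \<in> hom C (Dom C f) (Cod C f)"
  by (simp add: hom_def)

lemma is_zero_objectD:
  assumes "is_zero_object C Z" and "A \<in> Obj C"
  shows "\<exists>!f. f \<in> hom C A Z" and "\<exists>!f. f \<in> hom C Z A"
  using assms by (simp_all add: is_zero_object_def)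

text \<open>The description in \<open>zero_arr\<close> ranges over all zero objects and all
  factorisations, so it has to be shown independent of both. Two factorisations are compared along
  the arrow \<open>t\<close> between their zero objects: both resulting triangles commute because
  arrows into and out of a zero object are unique.\<close>

lemma zero_arr_eq:
  assumes Z: "is_zero_object C Z" and g: "g \<in> hom C A Z" and h: "h \<in> hom C Z B"
  shows "zero_arr C A B = h \<cdot> g"
  unfolding zero_arr_def
proof (rule the_equality)
  show "\<exists>Z' g' h'. is_zero_object C Z' \<and> g' \<in> hom C A Z' \<and> h' \<in> hom C Z' B \<and> h \<cdot> g = h' \<cdot> g'"
    using assms by blast
next
  fix f
  assume "\<exists>Z' g' h'. is_zero_object C Z' \<and> g' \<in> hom C A Z' \<and> h' \<in> hom C Z' B \<and> f = h' \<cdot> g'"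
  then obtain Z' g' h' where Z': "is_zero_object C Z'" and g': "g' \<in> hom C A Z'"
    and h': "h' \<in> hom C Z' B" and f: "f = h' \<cdot> g'" by blast
  obtain t where t: "t \<in> hom C Z Z'"
    using is_zero_objectD(1)[OF Z'] homD[OF g] by metis
  have "t \<cdot> g = g'"
    using is_zero_objectD(1)[OF Z'] homD[OF g] Comp_hom[OF g t] g' by metis
  moreover have "h' \<cdot> t = h"
    using is_zero_objectD(2)[OF Z] homD[OF h] Comp_hom[OF t h'] h by metis
  ultimately show "f = h \<cdot> g"
    using Comp_assoc[OF g t h'] f by simp
qed

lemma zero_arr_factor:
  assumes "A \<in> Obj C" "B \<in> Obj C"
  obtains Z g h where "is_zero_object C Z" "g \<in> hom C A Z" "h \<in> hom C Z B"
  using zero_object is_zero_objectD assms by metis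

lemma zero_arr_hom:
  assumes "A \<in> Obj C" "B \<in> Obj C"
  shows "zero_arr C A B \<in> hom C A B"
  using assms zero_arr_factor zero_arr_eq Comp_hom by metis

lemma Comp_zero_arr:
  assumes A: "A \<in> Obj C" and f: "f \<in> hom C B D"
  shows "f \<cdot> zero_arr C A B = zero_arr C A D"
proof -
  obtain Z g h where Z: "is_zero_object C Z" and g: "g \<in> hom C A Z" and h: "h \<in> hom C Z B"
    using zero_arr_factor A homD[OF f] by metis
  show ?thesis
    using zero_arr_eq[OF Z g h] zero_arr_eq[OF Z g Comp_hom[OF h f]] Comp_assoc[OF g h f] by simp
qed

lemma zero_arr_Comp:
  assumes D: "D \<in> Obj C" and f: "f \<in> hom C A B"
  shows "zero_arr C B D \<cdot> f = zero_arr C A D"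
proof -
  obtain Z g h where Z: "is_zero_object C Z" and g: "g \<in> hom C B Z" and h: "h \<in> hom C Z D"
    using zero_arr_factor D homD[OF f] by metis
  show ?thesis
    using zero_arr_eq[OF Z g h] zero_arr_eq[OF Z Comp_hom[OF f g] h] Comp_assoc[OF f g h] by simp
qed

section \<open>Copairings and sums of morphisms\<close>

lemma Inl_hom: "A \<in> Obj C \<Longrightarrow> B \<in> Obj C \<Longrightarrow> Inl C A B \<in> hom C A (Sum C A B)"
  and Inr_hom: "A \<in> Obj C \<Longrightarrow> B \<in> Obj C \<Longrightarrow> Inr C A B \<in> hom C B (Sum C A B)"
  using Sum unfolding is_coproduct_def by blast+

lemma copair:
  assumes f: "f \<in> hom C A X" and g: "g \<in> hom C B X"
  shows copair_hom: "copair C f g \<in> hom C (Sum C A B) X"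
    and copair_Inl: "copair C f g \<cdot> Inl C A B = f"
    and copair_Inr: "copair C f g \<cdot> Inr C A B = g"
proof -
  have "\<exists>!u. u \<in> hom C (Sum C A B) X \<and> u \<cdot> Inl C A B = f \<and> u \<cdot> Inr C A B = g"
    using Sum[of A B] homD[OF f] homD[OF g] f g unfolding is_coproduct_def by blast
  from theI'[OF this] show "copair C f g \<in> hom C (Sum C A B) X"
    "copair C f g \<cdot> Inl C A B = f" "copair C f g \<cdot> Inr C A B = g"
    using homD[OF f] homD[OF g] by (simp_all add: copair_def)
qed

text \<open>The inclusions are jointly epic, by the uniqueness half of the universal
  property.\<close>

lemma Sum_ext:
  assumes "A \<in> Obj C" "B \<in> Obj C" and u: "u \<in> hom C (Sum C A B) X" and v: "v \<in> hom C (Sum C A B) X"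
    and eq: "u \<cdot> Inl C A B = v \<cdot> Inl C A B" "u \<cdot> Inr C A B = v \<cdot> Inr C A B"
  shows "u = v"
proof -
  have "v \<cdot> Inl C A B \<in> hom C A X" "v \<cdot> Inr C A B \<in> hom C B X"
    using assms Comp_hom Inl_hom Inr_hom by blast+
  then have "\<exists>!w. w \<in> hom C (Sum C A B) X
      \<and> w \<cdot> Inl C A B = v \<cdot> Inl C A B \<and> w \<cdot> Inr C A B = v \<cdot> Inr C A B"
    using Sum[of A B] assms(1,2) unfolding is_coproduct_def by blast
  then show ?thesis
    using u v eq by blast
qed

lemma Comp_copair:
  assumes f: "f \<in> hom C A X" and g: "g \<in> hom C B X" and h: "h \<in> hom C X Y"
  shows "h \<cdot> copair C f g = copair C (h \<cdot> f) (h \<cdot> g)"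
proof (rule Sum_ext)
  show A: "A \<in> Obj C" and B: "B \<in> Obj C" using homD[OF f] homD[OF g] by auto
  note c = copair[OF f g] and d = copair[OF Comp_hom[OF f h] Comp_hom[OF g h]]
  show "h \<cdot> copair C f g \<in> hom C (Sum C A B) Y" using c(1) h by (rule Comp_hom)
  show "copair C (h \<cdot> f) (h \<cdot> g) \<in> hom C (Sum C A B) Y" by (rule d(1))
  show "(h \<cdot> copair C f g) \<cdot> Inl C A B = copair C (h \<cdot> f) (h \<cdot> g) \<cdot> Inl C A B"
    using Comp_assoc[OF Inl_hom[OF A B] c(1) h] c d by simp
  show "(h \<cdot> copair C f g) \<cdot> Inr C A B = copair C (h \<cdot> f) (h \<cdot> g) \<cdot> Inr C A B"
    using Comp_assoc[OF Inr_hom[OF A B] c(1) h] c d by simp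
qed

lemma sum_map_hom:
  assumes f: "f \<in> hom C A A'" and g: "g \<in> hom C B B'"
  shows "sum_map C f g \<in> hom C (Sum C A B) (Sum C A' B')"
  unfolding sum_map_def
  using homD[OF f] homD[OF g] copair_hom[OF Comp_hom[OF f Inl_hom] Comp_hom[OF g Inr_hom]] by simp

lemma copair_sum_map:
  assumes f: "f \<in> hom C A A'" and g: "g \<in> hom C B B'"
    and h: "h \<in> hom C A' X" and k: "k \<in> hom C B' X"
  shows "copair C h k \<cdot> sum_map C f g = copair C (h \<cdot> f) (k \<cdot> g)"
proof -
  have l: "Inl C A' B' \<in> hom C A' (Sum C A' B')" and r: "Inr C A' B' \<in> hom C B' (Sum C A' B')"
    using homD[OF f] homD[OF g] Inl_hom Inr_hom by auto
  note c = copair[OF h k]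
  show ?thesis
    using homD[OF f] homD[OF g] Comp_copair[OF Comp_hom[OF f l] Comp_hom[OF g r] c(1)]
      Comp_assoc[OF f l c(1)] Comp_assoc[OF g r c(1)] c(2,3)
    by (simp add: sum_map_def)
qed

section \<open>The kernel \<open>flat C A B\<close> and its functoriality\<close>

lemma copair_Id_zero_hom:
  "A \<in> Obj C \<Longrightarrow> B \<in> Obj C \<Longrightarrow> copair C (Id C A) (zero_arr C B A) \<in> hom C (Sum C A B) A"
  by (intro copair_hom Id_hom zero_arr_hom)

lemma flat_ker_is_kernel:
  "A \<in> Obj C \<Longrightarrow> B \<in> Obj C \<Longrightarrow> is_kernel C (copair C (Id C A) (zero_arr C B A)) (flat_ker C A B)"
  unfolding flat_ker_def using Ker copair_Id_zero_hom homD by blast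

lemma flat_ker_hom:
  assumes "A \<in> Obj C" "B \<in> Obj C"
  shows "flat_ker C A B \<in> hom C (flat C A B) (Sum C A B)"
  using flat_ker_is_kernel[OF assms] homD[OF copair_Id_zero_hom[OF assms]]
  by (simp add: is_kernel_def flat_def hom_def)

lemma copair_flat_ker:
  assumes "A \<in> Obj C" "B \<in> Obj C"
  shows "copair C (Id C A) (zero_arr C B A) \<cdot> flat_ker C A B = zero_arr C (flat C A B) A"
  using flat_ker_is_kernel[OF assms] homD[OF copair_Id_zero_hom[OF assms]]
  by (simp add: is_kernel_def flat_def)

lemma flat_ker_universal:
  assumes "A \<in> Obj C" "B \<in> Obj C" "h \<in> hom C X (Sum C A B)"
    "copair C (Id C A) (zero_arr C B A) \<cdot> h = zero_arr C X A"
  shows "\<exists>!u. u \<in> hom C X (flat C A B) \<and> flat_ker C A B \<cdot> u = h"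
  using flat_ker_is_kernel[OF assms(1,2)] homD[OF copair_Id_zero_hom[OF assms(1,2)]] assms(3,4)
  by (simp add: is_kernel_def flat_def)

text \<open>The restriction to kernels exists because \<open>sum_map C f g\<close> is compatible
  with the retractions \<open>[1, 0]\<close>, so it carries the kernel of one into the kernel of the
  other.\<close>

lemma flat_map:
  assumes f: "f \<in> hom C A A'" and g: "g \<in> hom C B B'"
  shows flat_map_hom: "flat_map C f g \<in> hom C (flat C A B) (flat C A' B')"
    and flat_ker_flat_map: "flat_ker C A' B' \<cdot> flat_map C f g = sum_map C f g \<cdot> flat_ker C A B"
proof -
  have obj: "A \<in> Obj C" "B \<in> Obj C" "A' \<in> Obj C" "B' \<in> Obj C"
    using homD[OF f] homD[OF g] by auto
  note k = flat_ker_hom[OF obj(1,2)] and s = sum_map_hom[OF f g]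
  let ?p = "copair C (Id C A) (zero_arr C B A)" and ?p' = "copair C (Id C A') (zero_arr C B' A')"
  \<comment> \<open>Both composites are \<open>[f, 0]\<close>.\<close>
  have "?p' \<cdot> sum_map C f g = f \<cdot> ?p"
    using copair_sum_map[OF f g Id_hom zero_arr_hom] Comp_copair[OF Id_hom zero_arr_hom f] obj
      Id_Comp[OF f] Comp_Id[OF f] Comp_zero_arr[OF obj(2) f] zero_arr_Comp[OF obj(3) g]
    by simp
  then have "?p' \<cdot> (sum_map C f g \<cdot> flat_ker C A B) = zero_arr C (flat C A B) A'"
    using Comp_assoc[OF k s copair_Id_zero_hom[OF obj(3,4)]]
      Comp_assoc[OF k copair_Id_zero_hom[OF obj(1,2)] f]
      copair_flat_ker[OF obj(1,2)] Comp_zero_arr[OF _ f] homD[OF k]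
    by simp
  from theI'[OF flat_ker_universal[OF obj(3,4) Comp_hom[OF k s] this]]
  show "flat_map C f g \<in> hom C (flat C A B) (flat C A' B')"
    "flat_ker C A' B' \<cdot> flat_map C f g = sum_map C f g \<cdot> flat_ker C A B"
    using homD[OF f] homD[OF g] by (simp_all add: flat_map_def)
qed

section \<open>Conjugation and the actions induced by a crossed module\<close>

text \<open>The sum of \<open>f\<close> and \<open>g\<close> is split into two stages,
  \<open>[f, g] = [1, 1] \<circ> (1 + g) \<circ> (f + 1)\<close>, and the kernels are natural in
  each variable. The order of the stages matters: it places \<open>flat_map C (Id C L) g\<close>
  next to the conjugation action, where equivariance can be applied to it.\<close>

lemma copair_flat_ker_conj_action:
  assumes f: "f \<in> hom C A L" and g: "g \<in> hom C B L"
  shows "copair C f g \<cdot> flat_ker C A B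
    = conj_action C L \<cdot> (flat_map C (Id C L) g \<cdot> flat_map C f (Id C B))"
proof -
  have obj: "A \<in> Obj C" "B \<in> Obj C" "L \<in> Obj C"
    using homD[OF f] homD[OF g] by auto
  note iL = Id_hom[OF obj(3)] and iB = Id_hom[OF obj(2)]
  note F = flat_map[OF f iB] and G = flat_map[OF iL g]
  note k = flat_ker_hom[OF obj(1,2)] and k' = flat_ker_hom[OF obj(3,2)]
    and kL = flat_ker_hom[OF obj(3,3)]
  note s = sum_map_hom[OF f iB] and t = sum_map_hom[OF iL g]
  let ?c = "copair C (Id C L) (Id C L)"
  note c = copair_hom[OF iL iL]
  have "conj_action C L \<cdot> (flat_map C (Id C L) g \<cdot> flat_map C f (Id C B))
      = ?c \<cdot> ((flat_ker C L L \<cdot> flat_map C (Id C L) g) \<cdot> flat_map C f (Id C B))"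
    using Comp_assoc[OF Comp_hom[OF F(1) G(1)] kL c] Comp_assoc[OF F(1) G(1) kL]
    by (simp add: conj_action_def)
  \<comment> \<open>Naturality of \<open>flat_ker\<close> in the second variable moves the kernel to
    the right, so that \<open>[1, 1]\<close> can absorb \<open>1 + g\<close>; the same is then done
    in the first variable with \<open>f + 1\<close>.\<close>
  also have "\<dots> = (?c \<cdot> sum_map C (Id C L) g) \<cdot> (flat_ker C L B \<cdot> flat_map C f (Id C B))"
    using G(2) Comp_assoc[OF F(1) k' t] Comp_assoc[OF Comp_hom[OF F(1) k'] t c] by simp
  also have "?c \<cdot> sum_map C (Id C L) g = copair C (Id C L) g"
    using copair_sum_map[OF iL g iL iL] Id_Comp[OF iL] Id_Comp[OF g] by simp
  also have "copair C (Id C L) g \<cdot> (flat_ker C L B \<cdot> flat_map C f (Id C B))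
      = (copair C (Id C L) g \<cdot> sum_map C f (Id C B)) \<cdot> flat_ker C A B"
    using F(2) Comp_assoc[OF k s copair_hom[OF iL g]] by simp
  also have "copair C (Id C L) g \<cdot> sum_map C f (Id C B) = copair C f g"
    using copair_sum_map[OF f iB iL g] Id_Comp[OF f] Comp_Id[OF g] by simp
  finally show ?thesis by simp
qed

text \<open>After restricting the action along \<open>f\<close>, acting and then applying
  \<open>d\<close> amounts to conjugating inside \<open>L\<close>. This is equivariance of
  \<open>d\<close>, precomposed with \<open>flat_map C f (Id C X)\<close>.\<close>

lemma crossed_module_induced_action:
  assumes d: "internal_crossed_module C X L d \<xi>" and f: "f \<in> hom C A L"
  shows "copair C f d \<cdot> flat_ker C A X = d \<cdot> (\<xi> \<cdot> flat_map C f (Id C X))"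
proof -
  have dh: "d \<in> hom C X L" and xi: "\<xi> \<in> hom C (flat C L X) X"
    and equivariant: "d \<cdot> \<xi> = conj_action C L \<cdot> flat_map C (Id C L) d"
    using d by (auto simp: internal_crossed_module_def internal_action_def)
  have obj: "X \<in> Obj C" "L \<in> Obj C" using homD[OF dh] by auto
  note F = flat_map_hom[OF f Id_hom[OF obj(1)]] and G = flat_map_hom[OF Id_hom[OF obj(2)] dh]
  have chi: "conj_action C L \<in> hom C (flat C L L) L"
    unfolding conj_action_def
    using Comp_hom[OF flat_ker_hom copair_hom[OF Id_hom Id_hom]] obj by simp
  show ?thesis
    using copair_flat_ker_conj_action[OF f dh] Comp_assoc[OF F G chi] Comp_assoc[OF F xi dh]
      equivariant by simp
qed

section \<open>Factorisation through the Peiffer product\<close>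

text \<open>Both sides equal \<open>[\<mu> \<circ> \<xi>NM, \<nu> \<circ> \<xi>MN]\<close>; each
  summand is one instance of the previous lemma, with the roles of \<open>M\<close> and
  \<open>N\<close> exchanged.\<close>

lemma copair_coequalises:
  assumes \<mu>: "internal_crossed_module C M L \<mu> \<xi>LM" and \<nu>: "internal_crossed_module C N L \<nu> \<xi>LN"
    and \<xi>N: "\<xi>MN = \<xi>LN \<cdot> flat_map C \<mu> (Id C N)" and \<xi>M: "\<xi>NM = \<xi>LM \<cdot> flat_map C \<nu> (Id C M)"
  shows "copair C \<mu> \<nu> \<cdot> flat_kers C M N = copair C \<mu> \<nu> \<cdot> sum_map C \<xi>NM \<xi>MN"
proof -
  have mh: "\<mu> \<in> hom C M L" and nh: "\<nu> \<in> hom C N L"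
    and xM: "\<xi>LM \<in> hom C (flat C L M) M" and xN: "\<xi>LN \<in> hom C (flat C L N) N"
    using \<mu> \<nu> by (auto simp: internal_crossed_module_def internal_action_def)
  have obj: "M \<in> Obj C" "N \<in> Obj C"
    using homD[OF mh] homD[OF nh] by auto
  have \<xi>Mh: "\<xi>NM \<in> hom C (flat C N M) M" and \<xi>Nh: "\<xi>MN \<in> hom C (flat C M N) N"
    unfolding \<xi>N \<xi>M
    using Comp_hom[OF flat_map_hom[OF nh Id_hom] xM] Comp_hom[OF flat_map_hom[OF mh Id_hom] xN] obj
    by auto
  note kNM = flat_ker_hom[OF obj(2,1)] and kMN = flat_ker_hom[OF obj]
  note l = Inl_hom[OF obj] and r = Inr_hom[OF obj]
  note c = copair[OF mh nh]
  have sw: "sum_swap C N M \<in> hom C (Sum C N M) (Sum C M N)"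
    unfolding sum_swap_def by (rule copair_hom[OF r l])
  \<comment> \<open>The kernel of \<open>N \<flat> M\<close> lands in \<open>N + M\<close>; undoing
    the swap brings the first summand into the form of the previous lemma.\<close>
  have "copair C \<mu> \<nu> \<cdot> sum_swap C N M = copair C \<nu> \<mu>"
    unfolding sum_swap_def using Comp_copair[OF r l c(1)] c(2,3) by simp
  then have "copair C \<mu> \<nu> \<cdot> (sum_swap C N M \<cdot> flat_ker C N M) = \<mu> \<cdot> \<xi>NM"
    using Comp_assoc[OF kNM sw c(1)] crossed_module_induced_action[OF \<mu> nh] \<xi>M by simp
  then have "copair C \<mu> \<nu> \<cdot> flat_kers C M N = copair C (\<mu> \<cdot> \<xi>NM) (\<nu> \<cdot> \<xi>MN)"
    unfolding flat_kers_def
    using Comp_copair[OF Comp_hom[OF kNM sw] kMN c(1)] crossed_module_induced_action[OF \<nu> mh] \<xi>N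
    by simp
  then show ?thesis
    using copair_sum_map[OF \<xi>Mh \<xi>Nh mh nh] by simp
qed

text \<open>By joint epimorphy of the inclusions, factoring \<open>[h, k]\<close> through
  \<open>q\<close> is the same as prescribing the two composites with \<open>q \<circ> i\<close>, so
  existence and uniqueness both transfer from the coequaliser.\<close>

lemma coequaliser_out_of_Sum:
  assumes q: "is_coequaliser C f g q" and f: "Cod C f = Sum C A B"
    and h: "h \<in> hom C A X" and k: "k \<in> hom C B X"
    and eq: "copair C h k \<cdot> f = copair C h k \<cdot> g"
  shows "\<exists>!\<phi>. \<phi> \<in> hom C (Cod C q) X \<and> \<phi> \<cdot> (q \<cdot> Inl C A B) = h \<and> \<phi> \<cdot> (q \<cdot> Inr C A B) = k"
proof -
  have obj: "A \<in> Obj C" "B \<in> Obj C" using homD[OF h] homD[OF k] by auto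
  note l = Inl_hom[OF obj] and r = Inr_hom[OF obj]
  note c = copair[OF h k]
  have qh: "q \<in> hom C (Sum C A B) (Cod C q)"
    using q f homI[of q] by (simp add: is_coequaliser_def)
  have universal: "\<exists>!\<phi>. \<phi> \<in> hom C (Cod C q) X \<and> \<phi> \<cdot> q = copair C h k"
    using q c(1) f eq by (simp add: is_coequaliser_def)
  have "\<phi> \<cdot> q = copair C h k \<longleftrightarrow> \<phi> \<cdot> (q \<cdot> Inl C A B) = h \<and> \<phi> \<cdot> (q \<cdot> Inr C A B) = k"
    if \<phi>: "\<phi> \<in> hom C (Cod C q) X" for \<phi>
    using Comp_assoc[OF l qh \<phi>] Comp_assoc[OF r qh \<phi>] c
      Sum_ext[OF obj Comp_hom[OF qh \<phi>] c(1)] by auto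
  with universal show ?thesis by (metis (no_types, lifting))
qed

end

theorem proposition4p1:
  fixes C :: "('o, 'm, 'z) chosen_cat_scheme" (structure)
    and M N :: 'o
    and \<xi>MN \<xi>NM q lM lN :: 'm
  assumes "semi_abelian C"
    and "chosen_limits C"
    and "smith_is_huq C"
    and "compatible_actions C M N \<xi>MN \<xi>NM"
    and "is_peiffer_product C M N \<xi>MN \<xi>NM q"
    and "lM = q \<cdot> Inl C M N"
    and "lN = q \<cdot> Inr C M N"
  shows "\<forall>L \<mu> \<nu> \<xi>LM \<xi>LN.
    internal_crossed_module C M L \<mu> \<xi>LM \<and>
    internal_crossed_module C N L \<nu> \<xi>LN \<and>
    \<xi>MN = \<xi>LN \<cdot> flat_map C \<mu> (Id C N) \<and>
    \<xi>NM = \<xi>LM \<cdot> flat_map C \<nu> (Id C M)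
    \<longrightarrow> (\<exists>!\<phi>. \<phi> \<in> hom C (Cod C q) L \<and> \<phi> \<cdot> lM = \<mu> \<and> \<phi> \<cdot> lN = \<nu>)"
proof (intro allI impI, elim conjE)
  fix L \<mu> \<nu> \<xi>LM \<xi>LN
  assume \<mu>: "internal_crossed_module C M L \<mu> \<xi>LM" and \<nu>: "internal_crossed_module C N L \<nu> \<xi>LN"
    and \<xi>: "\<xi>MN = \<xi>LN \<cdot> flat_map C \<mu> (Id C N)" "\<xi>NM = \<xi>LM \<cdot> flat_map C \<nu> (Id C M)"
  interpret pointed_chosen_limits C
    using assms(1,2) semi_abelian.axioms(1) semi_abelian.pointed
    by (blast intro: pointed_chosen_limits.intro pointed_chosen_limits_axioms.intro)
  have q: "is_coequaliser C (flat_kers C M N) (sum_map C \<xi>NM \<xi>MN) q"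
    using assms(5) by (simp add: is_peiffer_product_def)
  have "\<xi>NM \<in> hom C (flat C N M) M" "\<xi>MN \<in> hom C (flat C M N) N"
    using assms(4) by (auto simp: compatible_actions_def internal_action_def)
  \<comment> \<open>The types of the two actions fix the codomain of
    \<open>sum_map C \<xi>NM \<xi>MN\<close>, and a coequaliser is taken of a parallel pair, so
    \<open>flat_kers C M N\<close> has the same codomain.\<close>
  then have "Cod C (flat_kers C M N) = Sum C M N"
    using sum_map_hom homD q unfolding is_coequaliser_def by metis
  then show "\<exists>!\<phi>. \<phi> \<in> hom C (Cod C q) L \<and> \<phi> \<cdot> lM = \<mu> \<and> \<phi> \<cdot> lN = \<nu>"
    unfolding assms(6,7)
    using coequaliser_out_of_Sum[OF q] copair_coequalises[OF \<mu> \<nu> \<xi>] \<mu> \<nu>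
    by (simp add: internal_crossed_module_def)
qed

end
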